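(* Let $\widetilde H$ be an $\mathcal{H}_h(p,\epsilon)$-matrix format of the matrix $H\in\mathbb{R}^{N\times N}$ (built on a balanced $2^d$-tree of depth $L$ with switching level $\ell$ and admissibility parameter $\eta$), and let $\widehat H$ denote its mixed precision hierarchical matrix representation, in which the low-rank factors corresponding to the admissible block $I\times J$ at level $l$ (where $I,J$ are the index sets of the clusters $\mathcal{C}_i^{(l)},\mathcal{C}_j^{(l)}$) are stored in precision $u_{i,j}^{(l)}$. Define $$\xi_{i,j}^{(l)}:=\frac{\|\widetilde H_{I,J}^{(l)}\|}{\|\widetilde H\|},\qquad 1\le i\ne j\le 2^{dl},\ 1\le l\le L.$$ If the precision $u_{i,j}^{(l)}$ satisfies $$u_{i,j}^{(l)}\le \frac{\epsilon}{2^{dl/2}\,\xi_{i,j}^{(l)}}$$ (for every admissible block), then the global error bound for $\mathcal{H}_h$-matrices is $$\|H-\widehat H\|\lesssim\Bigl(2\sqrt{\ell C'+C''+(L-\ell)C'''}+1\Bigr)\,\epsilon\,\|H\|,$$ where the constants $C'=(2^d-1)(1+2\sqrt d/\eta)^d$ and $C''=(1+2\sqrt d/\eta)^d-1$ depend on the underlying dimension $d$ and the admissibility parameter $\eta$, and $C'''=2^d-1$ depends only on $d$.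
   Context: All norms $\|\cdot\|$ are Frobenius norms. The notation $\lesssim$ means that the inequality holds after dropping negligible terms of second and higher order. Tree. $N$ points lie in a hypercube $C\subset\mathbb{R}^d$; the rows and columns of $H\in\mathbb{R}^{N\times N}$ are indexed by the points. The balanced $2^d$-tree of depth $L$ has root $C$ at level $0$; each hypercube at level $l<L$ is subdivided into $2^d$ finer hypercubes (its children) at level $l+1$. So level $l$ has hypercubes $C_i^{(l)}$, $1\le i\le 2^{dl}$. The cluster $\mathcal{C}_i^{(l)}$ is the set of indices of the points in $C_i^{(l)}$. For clusters $\mathcal{C}_i^{(l)},\mathcal{C}_j^{(l)}$ with index sets $I,J$, $H^{(l)}_{I,J}$ is the corresponding submatrix of $H$. Standard admissibility (parameter $\eta>0$): for two distinct clusters at the same level, $\mathrm{adm}_s(\mathcal{C}_i,\mathcal{C}_j)$ is true iff $\min(\mathrm{diam}(C_i),\mathrm{diam}(C_j))\le \eta\,\mathrm{dist}(C_i,C_j)$, where $\mathrm{diam}$ and $\mathrm{dist}$ are the Euclidean diameter and distance of the hypercubes; a cluster is inadmissible with itself. At a given level, $\mathcal{IL}_s(\mathcal{C}_i)=\{\mathcal{C}_j:\mathrm{adm}_s(\mathcal{C}_i,\mathcal{C}_j)\text{ true and } \mathrm{adm}_s(\mathrm{parent}(\mathcal{C}_i),\mathrm{parent}(\mathcal{C}_j))\text{ false}\}$, $\mathcal{N}_s(\mathcal{C}_i)=\{\mathcal{C}_j: \mathrm{adm}_s(\mathcal{C}_i,\mathcal{C}_j)\text{ false},\ j\ne i\}$,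 $\mathcal{IL}_w(\mathcal{C}_i)=\{\mathcal{C}_j: j\neq i,\ \mathcal{C}_j \text{ has the same parent as } \mathcal{C}_i\}$ (weak admissibility). At every level, $|\mathcal{IL}_s(\mathcal{C}_i)|\le C'$, $|\mathcal{N}_s(\mathcal{C}_i)|\le C''$, and $|\mathcal{IL}_w(\mathcal{C}_i)|=C'''$. Hybrid block partition with switching level $\ell$, $0\le\ell\le L$. The matrix is partitioned into: (1) the blocks $I\times J$ at levels $1\le l\le\ell$ with $\mathcal{C}_j^{(l)}\in\mathcal{IL}_s(\mathcal{C}_i^{(l)})$; (2) the blocks at level $\ell$ with $\mathcal{C}_j^{(\ell)}\in\mathcal{N}_s(\mathcal{C}_i^{(\ell)})$; (3) the blocks at levels $\ell+1\le l\le L$ with $\mathcal{C}_j^{(l)}\in\mathcal{IL}_w(\mathcal{C}_i^{(l)})$; (4) the diagonal blocks $I\times I$ at level $L$. The blocks in (1)–(3) are the admissible blocks, except that when $\ell=L$ the blocks in (2) may be kept dense. Blocks that are kept dense, in particular those in (4), are copied: $\widetilde H_{I,J}=H_{I,J}$. The hybrid hierarchical representation $\widetilde H$ of $H$ is an $\mathcal{H}_h(p,\epsilon)$-matrix if every admissible block satisfies $\mathrm{rank}(\widetilde H^{(l)}_{I,J})\le p$ and $\|H^{(l)}_{I,J}-\widetilde H^{(l)}_{I,J}\|\le \epsilon\|H^{(l)}_{I,J}\|$. Mixed precision representation. "Precision $u$" means a floating-point format with unit roundoff $u$; the standard model of floating-point arithmetic is used. Each admissible block is represented as $\widetilde H^{(l)}_{I,J}=\widetilde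 U^{(l)}_I(\widetilde V^{(l)}_J)^*$ with $\widetilde U_I^{(l)}\in\mathbb{R}^{|I|\times p}$ and $\widetilde V_J^{(l)}\in\mathbb{R}^{|J|\times p}$, where $\widetilde U_I^{(l)}$ is assumed to have columns orthonormal to the working precision $u$. In $\widehat H$ this block is $\widehat H^{(l)}_{I,J}=\widehat U^{(l)}_I(\widehat V^{(l)}_J)^*$, where $\widehat U^{(l)}_I,\widehat V^{(l)}_J$ are $\widetilde U^{(l)}_I,\widetilde V^{(l)}_J$ stored in precision $u_{i,j}^{(l)}$. The dense blocks, in particular the diagonal blocks at level $L$, are stored in working precision and are taken to be identical in $\widehat H$ and $\widetilde H$.
   Formalization: Besides the entrywise standard model, storing the orthonormal factor U in precision u is assumed to perturb it by at most u times its norm in the operator 2-norm; with the entrywise model alone the constant 2 fails (e.g. p=16, d=1, L=1, ℓ=0, η=2). *)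

theory Defs
  imports "HOL-Analysis.Analysis"
begin

section \<open>Cluster tree\<close>

text \<open>
  The root hypercube has lower corner \<open>a\<close> and side length \<open>s\<close>.  The hypercubes at level \<open>l\<close> are
  indexed by the multi-indices \<open>k\<close> with entries in \<open>{0..<2^l}\<close>, instead of by a single number
  \<open>1 \<le> i \<le> 2^(d*l)\<close>.  Hypercubes are half-open so that the clusters of one level are disjoint.
\<close>

definition nodes :: "nat \<Rightarrow> ('d::finite \<Rightarrow> nat) set" where
  "nodes l = {k. \<forall>c. k c < 2 ^ l}"

definition parent :: "('d \<Rightarrow> nat) \<Rightarrow> ('d \<Rightarrow> nat)" where
  "parent k = (\<lambda>c. k c div 2)"

definition cube :: "real^'d \<Rightarrow> real \<Rightarrow> nat \<Rightarrow> ('d::finite \<Rightarrow> nat) \<Rightarrow> (real^'d) set" where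
  "cube a s l k =
     {x. \<forall>c. a $ c + real (k c) * (s / 2 ^ l) \<le> x $ c \<and>
             x $ c < a $ c + real (k c + 1) * (s / 2 ^ l)}"

definition cluster ::
  "real^'d \<Rightarrow> real \<Rightarrow> ('n \<Rightarrow> real^'d) \<Rightarrow> nat \<Rightarrow> ('d::finite \<Rightarrow> nat) \<Rightarrow> 'n set" where
  "cluster a s pt l k = {n. pt n \<in> cube a s l k}"

definition adm_s ::
  "real^'d \<Rightarrow> real \<Rightarrow> real \<Rightarrow> nat \<Rightarrow> ('d::finite \<Rightarrow> nat) \<Rightarrow> ('d \<Rightarrow> nat) \<Rightarrow> bool" where
  "adm_s a s \<eta> l i j \<longleftrightarrow> i \<noteq> j \<and>
     min (diameter (cube a s l i)) (diameter (cube a s l j))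
       \<le> \<eta> * setdist (cube a s l i) (cube a s l j)"

text \<open>The following three sets are meant for \<open>l \<ge> 1\<close>, except \<open>Near_s\<close>, which also makes sense at
  the root level, where it is empty.\<close>

definition IL_s ::
  "real^'d \<Rightarrow> real \<Rightarrow> real \<Rightarrow> nat \<Rightarrow> ('d::finite \<Rightarrow> nat) \<Rightarrow> ('d \<Rightarrow> nat) set" where
  "IL_s a s \<eta> l i =
     {j \<in> nodes l. adm_s a s \<eta> l i j \<and> \<not> adm_s a s \<eta> (l - 1) (parent i) (parent j)}"

definition Near_s ::
  "real^'d \<Rightarrow> real \<Rightarrow> real \<Rightarrow> nat \<Rightarrow> ('d::finite \<Rightarrow> nat) \<Rightarrow> ('d \<Rightarrow> nat) set" where
  "Near_s a s \<eta> l i = {j \<in> nodes l. \<not> adm_s a s \<eta> l i j \<and> j \<noteq> i}"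

definition IL_w :: "nat \<Rightarrow> ('d::finite \<Rightarrow> nat) \<Rightarrow> ('d \<Rightarrow> nat) set" where
  "IL_w l i = {j \<in> nodes l. j \<noteq> i \<and> parent j = parent i}"

definition const1 :: "nat \<Rightarrow> real \<Rightarrow> real" where
  "const1 d \<eta> = (2 ^ d - 1) * (1 + 2 * sqrt (real d) / \<eta>) ^ d"

definition const2 :: "nat \<Rightarrow> real \<Rightarrow> real" where
  "const2 d \<eta> = (1 + 2 * sqrt (real d) / \<eta>) ^ d - 1"

definition const3 :: "nat \<Rightarrow> real" where
  "const3 d = 2 ^ d - 1"


section \<open>Hybrid block partition\<close>

text \<open>A block is a triple \<open>(l, i, j)\<close> of a level and two hypercube indices at that level;
  \<open>m\<close> is the switching level.\<close>

type_synonym 'd block = "nat \<times> ('d \<Rightarrow> nat) \<times> ('d \<Rightarrow> nat)"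

definition far_blocks :: "real^'d \<Rightarrow> real \<Rightarrow> real \<Rightarrow> nat \<Rightarrow> 'd::finite block set" where
  "far_blocks a s \<eta> m =
     {(l, i, j). 1 \<le> l \<and> l \<le> m \<and> i \<in> nodes l \<and> j \<in> IL_s a s \<eta> l i}"

definition near_blocks :: "real^'d \<Rightarrow> real \<Rightarrow> real \<Rightarrow> nat \<Rightarrow> 'd::finite block set" where
  "near_blocks a s \<eta> m = {(l, i, j). l = m \<and> i \<in> nodes l \<and> j \<in> Near_s a s \<eta> l i}"

definition weak_blocks :: "nat \<Rightarrow> nat \<Rightarrow> 'd::finite block set" where
  "weak_blocks m L = {(l, i, j). m + 1 \<le> l \<and> l \<le> L \<and> i \<in> nodes l \<and> j \<in> IL_w l i}"

definition diag_blocks :: "nat \<Rightarrow> 'd::finite block set" where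
  "diag_blocks L = {(l, i, j). l = L \<and> i \<in> nodes l \<and> j = i}"

text \<open>\<open>D\<close> is the set of off-diagonal blocks that are kept dense: such blocks may exist only if the
  switching level is \<open>L\<close>, and then they are near-field blocks.\<close>

definition dense_choice ::
  "real^'d \<Rightarrow> real \<Rightarrow> real \<Rightarrow> nat \<Rightarrow> nat \<Rightarrow> 'd::finite block set \<Rightarrow> bool" where
  "dense_choice a s \<eta> m L D \<longleftrightarrow> D \<subseteq> near_blocks a s \<eta> m \<and> (m \<noteq> L \<longrightarrow> D = {})"

definition dense_blocks :: "nat \<Rightarrow> 'd::finite block set \<Rightarrow> 'd block set" where
  "dense_blocks L D = diag_blocks L \<union> D"

definition adm_blocks ::
  "real^'d \<Rightarrow> real \<Rightarrow> real \<Rightarrow> nat \<Rightarrow> nat \<Rightarrow> 'd::finite block set \<Rightarrow> 'd block set" where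
  "adm_blocks a s \<eta> m L D =
     (far_blocks a s \<eta> m \<union> near_blocks a s \<eta> m \<union> weak_blocks m L) - D"


section \<open>Submatrices\<close>

text \<open>
  The submatrix with row set \<open>I\<close> and column set \<open>J\<close> is padded with zeros to full size, which changes
  neither its rank nor its Frobenius norm.  The Frobenius norm of a matrix of type \<open>real^'n^'m\<close> is
  the library's \<open>norm\<close> on this type.
\<close>

definition submat :: "'n set \<Rightarrow> 'n set \<Rightarrow> real^'n^'n \<Rightarrow> real^'n^'n" where
  "submat I J A = (\<chi> r c. if r \<in> I \<and> c \<in> J then A $ r $ c else 0)"

definition blk ::
  "real^'d \<Rightarrow> real \<Rightarrow> ('n \<Rightarrow> real^'d) \<Rightarrow> 'd::finite block \<Rightarrow> real^'n^'n \<Rightarrow> real^'n^'n" where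
  "blk a s pt b A =
     (case b of (l, i, j) \<Rightarrow> submat (cluster a s pt l i) (cluster a s pt l j) A)"

text \<open>Factors with rows indexed by \<open>I\<close> are likewise padded with zero rows.\<close>

definition rows_in :: "'n set \<Rightarrow> real^'p^'n \<Rightarrow> bool" where
  "rows_in I U \<longleftrightarrow> (\<forall>r. r \<notin> I \<longrightarrow> U $ r = 0)"


section \<open>Hierarchical matrices and their mixed precision representation\<close>

definition Hh_matrix ::
  "real^'d \<Rightarrow> real \<Rightarrow> ('n::finite \<Rightarrow> real^'d) \<Rightarrow> real \<Rightarrow> nat \<Rightarrow> nat \<Rightarrow> 'd::finite block set \<Rightarrow>
   nat \<Rightarrow> real \<Rightarrow> real^'n^'n \<Rightarrow> real^'n^'n \<Rightarrow> bool" where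
  "Hh_matrix a s pt \<eta> m L D p \<epsilon> H Ht \<longleftrightarrow>
     (\<forall>b \<in> adm_blocks a s \<eta> m L D.
        rank (blk a s pt b Ht) \<le> p \<and>
        norm (blk a s pt b H - blk a s pt b Ht) \<le> \<epsilon> * norm (blk a s pt b H)) \<and>
     (\<forall>b \<in> dense_blocks L D. blk a s pt b Ht = blk a s pt b H)"

text \<open>Standard model of floating-point arithmetic: each entry is stored with a relative error of at
  most the unit roundoff, \<open>fl(x) = x (1 + \<delta>)\<close> with \<open>\<bar>\<delta>\<bar> \<le> u\<close>.\<close>

definition stored_in :: "real \<Rightarrow> real^'p^'n \<Rightarrow> real^'p^'n \<Rightarrow> bool" where
  "stored_in u A Ahat \<longleftrightarrow>
     (\<forall>r c. \<exists>\<delta>. \<bar>\<delta>\<bar> \<le> u \<and> Ahat $ r $ c = A $ r $ c * (1 + \<delta>))"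

text \<open>\<open>\<kappa>\<close> is the constant in the deviation from orthonormality that working precision \<open>u\<close> permits.\<close>

definition orthonormal_cols_upto :: "real \<Rightarrow> real \<Rightarrow> real^'p^'n \<Rightarrow> bool" where
  "orthonormal_cols_upto \<kappa> u U \<longleftrightarrow> norm (transpose U ** U - mat 1) \<le> \<kappa> * u"

text \<open>
  The factors of the block \<open>b\<close> are \<open>U b\<close>, \<open>V b\<close>, and \<open>Uh b\<close>, \<open>Vh b\<close> are their stored versions.

  The bound in the operator 2-norm says that storing the orthonormal factor in precision \<open>u\<close> also
  perturbs it by a relative normwise error of at most \<open>u\<close>.  For \<open>p = 1\<close> it follows from
  \<open>stored_in\<close>.  For larger \<open>p\<close> the standard model alone only gives this bound with an additional
  factor of about \<open>sqrt p\<close>, which would enter the error bound of the block in the same way; the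
  first-order block error \<open>2 * u b * norm (blk a s pt b Ht)\<close> requires the bound without it.
\<close>

definition mixed_precision_rep ::
  "real^'d \<Rightarrow> real \<Rightarrow> ('n::finite \<Rightarrow> real^'d) \<Rightarrow> real \<Rightarrow> nat \<Rightarrow> nat \<Rightarrow> 'd::finite block set \<Rightarrow>
   real \<Rightarrow> real \<Rightarrow> ('d block \<Rightarrow> real) \<Rightarrow>
   ('d block \<Rightarrow> real^'p^'n) \<Rightarrow> ('d block \<Rightarrow> real^'p^'n) \<Rightarrow>
   ('d block \<Rightarrow> real^'p^'n) \<Rightarrow> ('d block \<Rightarrow> real^'p^'n) \<Rightarrow>
   real^'n^'n \<Rightarrow> real^'n^'n \<Rightarrow> bool" where
  "mixed_precision_rep a s pt \<eta> m L D \<kappa> w u U V Uh Vh Ht Hh \<longleftrightarrow>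
     (\<forall>(l, i, j) \<in> adm_blocks a s \<eta> m L D. let b = (l, i, j) in
        rows_in (cluster a s pt l i) (U b) \<and>
        rows_in (cluster a s pt l j) (V b) \<and>
        orthonormal_cols_upto \<kappa> w (U b) \<and>
        blk a s pt b Ht = U b ** transpose (V b) \<and>
        stored_in (u b) (U b) (Uh b) \<and>
        stored_in (u b) (V b) (Vh b) \<and>
        onorm (\<lambda>x. (Uh b - U b) *v x) \<le> u b * onorm (\<lambda>x. U b *v x) \<and>
        blk a s pt b Hh = Uh b ** transpose (Vh b)) \<and>
     (\<forall>b \<in> dense_blocks L D. blk a s pt b Hh = blk a s pt b Ht)"

definition xi :: "real^'d \<Rightarrow> real \<Rightarrow> ('n::finite \<Rightarrow> real^'d) \<Rightarrow> real^'n^'n \<Rightarrow>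
    'd::finite block \<Rightarrow> real" where
  "xi a s pt Ht b = norm (blk a s pt b Ht) / norm Ht"

text \<open>If \<open>xi\<close> vanishes, the upper bound on the precision is infinite, i.e. there is no condition.\<close>

definition precision_cond ::
  "real^'d \<Rightarrow> real \<Rightarrow> ('n::finite \<Rightarrow> real^'d) \<Rightarrow> real \<Rightarrow> nat \<Rightarrow> nat \<Rightarrow> 'd::finite block set \<Rightarrow>
   real \<Rightarrow> ('d block \<Rightarrow> real) \<Rightarrow> real^'n^'n \<Rightarrow> bool" where
  "precision_cond a s pt \<eta> m L D \<epsilon> u Ht \<longleftrightarrow>
     (\<forall>(l, i, j) \<in> adm_blocks a s \<eta> m L D.
        xi a s pt Ht (l, i, j) \<noteq> 0 \<longrightarrow>
        u (l, i, j) \<le> \<epsilon> / (2 powr (real (CARD('d) * l) / 2) * xi a s pt Ht (l, i, j)))"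

end

theory Submission
  imports Defs
begin

text \<open>
  The blocks of the hybrid partition cover every matrix entry exactly once
  (\<open>ex1_partition_block\<close>): for two points, the cubes of level \<open>l\<close> containing them coincide down to
  some level and, once admissible at some level, are admissible at all finer ones, so exactly one of
  the four kinds of blocks catches the pair, at exactly one level.  Squared Frobenius norms therefore add up over the
  blocks (\<open>norm_sq_eq_sum_blocks\<close>), and the blockwise relative error \<open>\<epsilon>\<close> of \<open>Ht\<close> gives
  \<open>\<parallel>H - Ht\<parallel> \<le> \<epsilon> \<parallel>H\<parallel>\<close>.  This is the summand \<open>1\<close> in the bound.

  Storing the two factors of a block \<open>b\<close> in precision \<open>u b\<close> changes the block by at most \<open>2 u b\<close>
  times its norm to first order, once \<open>u b\<close> for each factor (\<open>norm_rounded_product_diff_le\<close>).  By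
  the choice of \<open>u b\<close> this is at most \<open>2 \<epsilon> \<parallel>Ht\<parallel> / 2^(d l / 2)\<close>, independently of the block within
  the level (\<open>precision_cond_block\<close>).  After squaring, each block of level \<open>l\<close> counts
  \<open>1 / 2^(d l)\<close>, and a level has \<open>2^(d l)\<close> block rows with a bounded number of blocks each, so the
  counts sum to at most the number under the square root (\<open>sum_weight_adm_blocks_le\<close>).

  The second-order terms come from three sources: the product of the two rounding errors, the
  deviation of \<open>U b\<close> from orthonormality, and the replacement of \<open>\<parallel>Ht\<parallel>\<close> by \<open>\<parallel>H\<parallel>\<close>.
\<close>


section \<open>Cubes and the points they contain\<close>

definition cube_index :: "real^'d \<Rightarrow> real \<Rightarrow> nat \<Rightarrow> real^'d \<Rightarrow> ('d::finite \<Rightarrow> nat)" where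
  "cube_index a s l x = (\<lambda>c. nat \<lfloor>(x $ c - a $ c) / (s / 2 ^ l)\<rfloor>)"

lemma mem_cube_iff_cube_index:
  fixes a x :: "real^'d"
  assumes "0 < s" and "\<And>c. a $ c \<le> x $ c"
  shows "x \<in> cube a s l k \<longleftrightarrow> k = cube_index a s l x"
proof -
  define h where "h = s / 2 ^ l"
  have h: "0 < h" using assms(1) by (simp add: h_def)
  have coord: "a $ c + real (k c) * h \<le> x $ c \<and> x $ c < a $ c + real (k c + 1) * h
      \<longleftrightarrow> k c = nat \<lfloor>(x $ c - a $ c) / h\<rfloor>" for c
  proof -
    let ?t = "(x $ c - a $ c) / h"
    have t0: "0 \<le> ?t" using assms(2)[of c] h by simp
    have "a $ c + real (k c) * h \<le> x $ c \<and> x $ c < a $ c + real (k c + 1) * h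
        \<longleftrightarrow> real (k c) \<le> ?t \<and> ?t < real (k c) + 1"
      using h by (simp add: field_simps)
    also have "\<dots> \<longleftrightarrow> \<lfloor>?t\<rfloor> = int (k c)"
      by (simp add: floor_eq_iff)
    also have "\<dots> \<longleftrightarrow> k c = nat \<lfloor>?t\<rfloor>"
      using t0 by (auto simp: nat_eq_iff)
    finally show ?thesis .
  qed
  show ?thesis
    unfolding cube_def cube_index_def h_def[symmetric] fun_eq_iff using coord by auto
qed

lemma root_cube_coord_ge:
  assumes "x \<in> cube a s 0 (\<lambda>_. 0)" shows "a $ c \<le> x $ c"
  using assms by (simp add: cube_def)

lemma cube_index_in_nodes:
  fixes a x :: "real^'d"
  assumes "0 < s" and "x \<in> cube a s 0 (\<lambda>_. 0)"
  shows "cube_index a s l x \<in> nodes l"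
proof -
  have "cube_index a s l x c < 2 ^ l" for c
  proof -
    have "a $ c \<le> x $ c" "x $ c < a $ c + s" using assms by (simp_all add: cube_def)
    then have t: "0 \<le> (x $ c - a $ c) / (s / 2 ^ l)" "(x $ c - a $ c) / (s / 2 ^ l) < 2 ^ l"
      using \<open>0 < s\<close> by (simp_all add: pos_divide_less_eq)
    then have "\<lfloor>(x $ c - a $ c) / (s / 2 ^ l)\<rfloor> < 2 ^ l" by (simp add: floor_less_iff)
    then show ?thesis using t(1) by (simp add: cube_index_def nat_less_iff)
  qed
  then show ?thesis by (simp add: nodes_def)
qed

lemma cube_subset_parent:
  fixes a :: "real^'d"
  assumes "0 < s"
  shows "cube a s (Suc l) k \<subseteq> cube a s l (parent k)"
proof
  fix x assume x: "x \<in> cube a s (Suc l) k"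
  define h where "h = s / 2 ^ Suc l"
  have h: "0 < h" "s / 2 ^ l = 2 * h" using assms by (simp_all add: h_def)
  have "a $ c + real (k c div 2) * (2 * h) \<le> x $ c \<and> x $ c < a $ c + real (k c div 2 + 1) * (2 * h)"
    for c
  proof -
    have b: "a $ c + real (k c) * h \<le> x $ c" "x $ c < a $ c + real (k c + 1) * h"
      using x by (simp_all add: cube_def h_def)
    have "real (2 * (k c div 2)) * h \<le> real (k c) * h"
      using h by (intro mult_right_mono of_nat_mono) auto
    then have "real (k c div 2) * (2 * h) \<le> real (k c) * h"
      by (simp only: of_nat_mult of_nat_numeral mult_ac)
    moreover have "real (k c + 1) * h \<le> real (2 * (k c div 2 + 1)) * h"
      using h by (intro mult_right_mono of_nat_mono) auto
    then have "real (k c + 1) * h \<le> real (k c div 2 + 1) * (2 * h)"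
      by (simp only: of_nat_mult of_nat_numeral mult_ac)
    ultimately show ?thesis using b by linarith
  qed
  then show "x \<in> cube a s l (parent k)" by (simp add: cube_def parent_def h)
qed

lemma parent_cube_index:
  fixes a x :: "real^'d"
  assumes "0 < s" and "\<And>c. a $ c \<le> x $ c"
  shows "parent (cube_index a s (Suc l) x) = cube_index a s l x"
  using cube_subset_parent[OF assms(1)] mem_cube_iff_cube_index[OF assms] by blast

lemma bounded_cube: "bounded (cube a s l k)"
proof (rule bounded_subset[OF bounded_cbox])
  show "cube a s l k \<subseteq> cbox (\<chi> c. a $ c + real (k c) * (s / 2 ^ l))
                            (\<chi> c. a $ c + real (k c + 1) * (s / 2 ^ l))"
    by (auto simp: cube_def mem_box_cart less_imp_le)
qed

lemma cube_nonempty: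
  assumes "0 < s" shows "cube a s l k \<noteq> {}"
proof -
  have "(\<chi> c. a $ c + real (k c) * (s / 2 ^ l)) \<in> cube a s l k"
    using assms by (simp add: cube_def field_simps)
  then show ?thesis by blast
qed

text \<open>Passing to children shrinks diameters and enlarges distances, so admissibility is inherited.
  Hence along a pair of branches of the tree the far-field condition, admissible with inadmissible
  parents, can hold at one level only.\<close>

lemma adm_s_of_parents:
  fixes a :: "real^'d"
  assumes "0 < s" and "0 < \<eta>" and "adm_s a s \<eta> l (parent i) (parent j)"
  shows "adm_s a s \<eta> (Suc l) i j"
proof -
  note sub = cube_subset_parent[OF assms(1), of a l]
  have diam: "diameter (cube a s (Suc l) k) \<le> diameter (cube a s l (parent k))" for k
    by (rule diameter_subset[OF sub bounded_cube])
  have "setdist (cube a s l (parent i)) (cube a s l (parent j))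
      \<le> setdist (cube a s (Suc l) i) (cube a s l (parent j))"
    by (rule setdist_subset_left[OF cube_nonempty[OF assms(1)] sub])
  also have "\<dots> \<le> setdist (cube a s (Suc l) i) (cube a s (Suc l) j)"
    by (rule setdist_subset_right[OF cube_nonempty[OF assms(1)] sub])
  finally have "\<eta> * setdist (cube a s l (parent i)) (cube a s l (parent j))
      \<le> \<eta> * setdist (cube a s (Suc l) i) (cube a s (Suc l) j)"
    using assms(2) by simp
  then show ?thesis
    using assms(3) diam[of i] diam[of j] unfolding adm_s_def by (auto simp: min_le_iff_disj)
qed


section \<open>The hybrid partition covers every matrix entry exactly once\<close>

definition partition_blocks ::
  "real^'d \<Rightarrow> real \<Rightarrow> real \<Rightarrow> nat \<Rightarrow> nat \<Rightarrow> 'd::finite block set" where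
  "partition_blocks a s \<eta> m L =
     far_blocks a s \<eta> m \<union> near_blocks a s \<eta> m \<union> weak_blocks m L \<union> diag_blocks L"

text \<open>The combinatorial core of the partition property.  For a fixed matrix entry, \<open>E l\<close> stands for
  row and column point lying in the same cube of level \<open>l\<close>, and \<open>A l\<close> for their cubes of level \<open>l\<close>
  being admissible.  Descending the tree, \<open>E\<close> switches off at most once and \<open>A\<close> switches on at most
  once, not before \<open>E\<close> is off; the four disjuncts list where these two switches lie relative to \<open>m\<close>
  and \<open>L\<close>.\<close>

lemma ex1_partition_level:
  fixes A E :: "nat \<Rightarrow> bool"
  assumes A: "\<And>l. A l \<Longrightarrow> A (Suc l)" and E: "\<And>l. E (Suc l) \<Longrightarrow> E l"
    and AE: "\<And>l. A l \<Longrightarrow> \<not> E l" and "E 0" and "m \<le> L"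
  shows "\<exists>!l. (1 \<le> l \<and> l \<le> m \<and> A l \<and> \<not> A (l - 1)) \<or> (l = m \<and> \<not> A l \<and> \<not> E l)
            \<or> (m + 1 \<le> l \<and> l \<le> L \<and> \<not> E l \<and> E (l - 1)) \<or> (l = L \<and> E l)"
    (is "\<exists>!l. ?S l")
proof -
  have Amono: "A l'" if "A l" "l \<le> l'" for l l'
    using that(2,1) by (induction l' rule: dec_induct) (auto intro: A)
  have Emono: "E l" if "E l'" "l \<le> l'" for l l'
    using that(2,1) by (induction l' rule: dec_induct) (auto intro: E)
  \<comment> \<open>\<open>E\<close> is still on at level \<open>L\<close>, or switches off between \<open>m\<close> and \<open>L\<close>, or is off at \<open>m\<close>, where
     \<open>A\<close> is either already on or not\<close>
  have ex: "\<exists>l. ?S l"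
  proof (cases "E L")
    case True then show ?thesis by blast
  next
    case nEL: False
    show ?thesis
    proof (cases "E m")
      case True
      define l where "l = (LEAST l. \<not> E l)"
      have l: "\<not> E l" "l \<le> L" unfolding l_def using nEL by (rule LeastI, rule Least_le)
      have "m < l" using True l(1) Emono not_le by blast
      then have "E (l - 1)" using not_less_Least[of "l - 1" "\<lambda>l. \<not> E l"] by (simp add: l_def[symmetric])
      then show ?thesis using l \<open>m < l\<close> by (intro exI[of _ l]) auto
    next
      case nEm: False
      show ?thesis
      proof (cases "A m")
        case True
        define l where "l = (LEAST l. A l)"
        have l: "A l" "l \<le> m" unfolding l_def using True by (rule LeastI, rule Least_le)
        have "0 < l" using l(1) AE \<open>E 0\<close> by (metis gr0I)
        then have "\<not> A (l - 1)" using not_less_Least[of "l - 1" A] by (simp add: l_def[symmetric])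
        then show ?thesis using l \<open>0 < l\<close> by (intro exI[of _ l]) auto
      qed (use nEm in blast)
    qed
  qed
  have neq: False if "?S l" "?S l'" "l < l'" for l l'
  proof -
    have "l \<le> l' - 1" "l \<le> l'" using that(3) by auto
    then have "A l \<Longrightarrow> A (l' - 1)" "A l \<Longrightarrow> A l'" "E (l' - 1) \<Longrightarrow> E l" "E l' \<Longrightarrow> E l"
      using Amono Emono by blast+
    with AE[of "l' - 1"] AE[of l'] that \<open>m \<le> L\<close> show False by auto
  qed
  show ?thesis proof -
    obtain l where "?S l" using ex by blast
    moreover have "l' = l" if "?S l'" for l'
      using neq[OF that \<open>?S l\<close>] neq[OF \<open>?S l\<close> that] by (cases l' l rule: linorder_cases) auto
    ultimately show ?thesis by (rule ex1I)
  qed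
qed

lemma ex1_partition_block:
  fixes a x y :: "real^'d"
  assumes "0 < s" and "0 < \<eta>" and "m \<le> L"
    and x: "x \<in> cube a s 0 (\<lambda>_. 0)" and y: "y \<in> cube a s 0 (\<lambda>_. 0)"
  shows "\<exists>!b. b \<in> partition_blocks a s \<eta> m L \<and>
              (case b of (l, i, j) \<Rightarrow> x \<in> cube a s l i \<and> y \<in> cube a s l j)"
proof -
  let ?i = "\<lambda>l. cube_index a s l x" and ?j = "\<lambda>l. cube_index a s l y"
  note ge = root_cube_coord_ge[OF x] root_cube_coord_ge[OF y]
  have mem: "x \<in> cube a s l k \<longleftrightarrow> k = ?i l" "y \<in> cube a s l k \<longleftrightarrow> k = ?j l" for l k
    using mem_cube_iff_cube_index[OF \<open>0 < s\<close>] ge by blast+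
  have par: "parent (?i (Suc l)) = ?i l" "parent (?j (Suc l)) = ?j l" for l
    using parent_cube_index[OF \<open>0 < s\<close>] ge by blast+
  have par': "parent (?i l) = ?i (l - 1)" "parent (?j l) = ?j (l - 1)" if "1 \<le> l" for l
    using that par[of "l - 1"] by simp_all
  have nod: "?i l \<in> nodes l" "?j l \<in> nodes l" for l
    using cube_index_in_nodes[OF \<open>0 < s\<close>] x y by blast+
  define A where "A l \<longleftrightarrow> adm_s a s \<eta> l (?i l) (?j l)" for l
  define E where "E l \<longleftrightarrow> ?j l = ?i l" for l
  have "\<exists>!l. (1 \<le> l \<and> l \<le> m \<and> A l \<and> \<not> A (l - 1)) \<or> (l = m \<and> \<not> A l \<and> \<not> E l)
            \<or> (m + 1 \<le> l \<and> l \<le> L \<and> \<not> E l \<and> E (l - 1)) \<or> (l = L \<and> E l)"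
  proof (rule ex1_partition_level)
    show "A (Suc l)" if "A l" for l
      using that adm_s_of_parents[OF assms(1,2)] par unfolding A_def by metis
    show "E l" if "E (Suc l)" for l using that par unfolding E_def by metis
    show "\<not> E l" if "A l" for l using that by (auto simp: A_def E_def adm_s_def)
    show "E 0" using mem[where l = 0 and k = "\<lambda>_. 0"] x y by (simp add: E_def)
  qed fact
  moreover have "((1 \<le> l \<and> l \<le> m \<and> A l \<and> \<not> A (l - 1)) \<or> (l = m \<and> \<not> A l \<and> \<not> E l)
            \<or> (m + 1 \<le> l \<and> l \<le> L \<and> \<not> E l \<and> E (l - 1)) \<or> (l = L \<and> E l))
      \<longleftrightarrow> (l, ?i l, ?j l) \<in> partition_blocks a s \<eta> m L" for l
  proof -
    have far: "(l, ?i l, ?j l) \<in> far_blocks a s \<eta> m \<longleftrightarrow> 1 \<le> l \<and> l \<le> m \<and> A l \<and> \<not> A (l - 1)"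
      using nod[of l] par'[of l] by (auto simp: far_blocks_def IL_s_def A_def)
    have near: "(l, ?i l, ?j l) \<in> near_blocks a s \<eta> m \<longleftrightarrow> l = m \<and> \<not> A l \<and> \<not> E l"
      using nod[of l] by (auto simp: near_blocks_def Near_s_def A_def E_def)
    have weak: "(l, ?i l, ?j l) \<in> weak_blocks m L \<longleftrightarrow> m + 1 \<le> l \<and> l \<le> L \<and> \<not> E l \<and> E (l - 1)"
      using nod[of l] par'[of l] by (cases "1 \<le> l") (simp_all add: weak_blocks_def IL_w_def E_def)
    have diag: "(l, ?i l, ?j l) \<in> diag_blocks L \<longleftrightarrow> l = L \<and> E l"
      using nod[of l] by (auto simp: diag_blocks_def E_def)
    show ?thesis
      unfolding partition_blocks_def Un_iff far near weak diag by blast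
  qed
  ultimately have ex1: "\<exists>!l. (l, ?i l, ?j l) \<in> partition_blocks a s \<eta> m L" by simp
  then obtain l where l: "(l, ?i l, ?j l) \<in> partition_blocks a s \<eta> m L"
    and uniq: "\<forall>l'. (l', ?i l', ?j l') \<in> partition_blocks a s \<eta> m L \<longrightarrow> l' = l" by (rule ex1E)
  show ?thesis
  proof (rule ex1I[of _ "(l, ?i l, ?j l)"])
    fix b assume b: "b \<in> partition_blocks a s \<eta> m L \<and>
              (case b of (l, i, j) \<Rightarrow> x \<in> cube a s l i \<and> y \<in> cube a s l j)"
    obtain l' i j where [simp]: "b = (l', i, j)" by (cases b)
    from b show "b = (l, ?i l, ?j l)" using uniq by (auto simp: mem)
  qed (use l mem in auto)
qed

lemma finite_nodes: "finite (nodes l :: ('d::finite \<Rightarrow> nat) set)"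
  and card_nodes: "card (nodes l :: ('d::finite \<Rightarrow> nat) set) = 2 ^ (CARD('d) * l)"
proof -
  have eq: "(nodes l :: ('d \<Rightarrow> nat) set) = PiE UNIV (\<lambda>_. {..<2 ^ l})"
    by (auto simp: nodes_def)
  show "finite (nodes l :: ('d \<Rightarrow> nat) set)" unfolding eq by (intro finite_PiE) auto
  show "card (nodes l :: ('d \<Rightarrow> nat) set) = 2 ^ (CARD('d) * l)"
    unfolding eq by (simp add: card_PiE power_mult[symmetric] mult.commute)
qed

lemma finite_partition_blocks:
  assumes "m \<le> L" shows "finite (partition_blocks a s \<eta> m L)"
proof (rule finite_subset)
  show "partition_blocks a s \<eta> m L \<subseteq> (SIGMA l:{..L}. nodes l \<times> nodes l)"
    using assms by (auto simp: partition_blocks_def far_blocks_def near_blocks_def weak_blocks_def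
        diag_blocks_def IL_s_def Near_s_def IL_w_def)
qed (auto simp: finite_nodes)

lemma blk_diff: "blk a s pt b (A - B) = blk a s pt b A - blk a s pt b B"
proof -
  have "submat I J (A - B) = submat I J A - submat I J B" for I J
    by (simp add: submat_def vec_eq_iff)
  then show ?thesis by (simp add: blk_def split: prod.split)
qed

lemma norm_sq_rows:
  fixes B :: "real^'p^'k"
  shows "(norm B)\<^sup>2 = (\<Sum>r\<in>UNIV. (norm (B $ r))\<^sup>2)"
  by (simp add: norm_vec_def L2_set_def sum_nonneg)

lemma norm_vector_sq:
  fixes x :: "real^'n"
  shows "(norm x)\<^sup>2 = (\<Sum>i\<in>UNIV. (x $ i)\<^sup>2)"
  by (simp add: norm_vec_def L2_set_def sum_nonneg)

lemma norm_matrix_sq: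
  fixes A :: "real^'n^'m"
  shows "(norm A)\<^sup>2 = (\<Sum>r\<in>UNIV. \<Sum>c\<in>UNIV. (A $ r $ c)\<^sup>2)"
  by (simp add: norm_sq_rows norm_vector_sq)

text \<open>Because the blocks are a partition, squared Frobenius norms add up over them.\<close>

lemma norm_sq_eq_sum_blocks:
  fixes a :: "real^'d" and pt :: "'n::finite \<Rightarrow> real^'d" and A :: "real^'n^'n"
  assumes "0 < s" and "0 < \<eta>" and "m \<le> L" and "\<forall>n. pt n \<in> cube a s 0 (\<lambda>_. 0)"
  shows "(norm A)\<^sup>2 = (\<Sum>b\<in>partition_blocks a s \<eta> m L. (norm (blk a s pt b A))\<^sup>2)"
proof -
  let ?P = "partition_blocks a s \<eta> m L"
  define covers where "covers b r c \<longleftrightarrow>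
      (case b of (l, i, j) \<Rightarrow> pt r \<in> cube a s l i \<and> pt c \<in> cube a s l j)" for b r c
  have fin: "finite ?P" by (rule finite_partition_blocks) fact
  have entry: "(\<Sum>b\<in>?P. if covers b r c then (A $ r $ c)\<^sup>2 else 0) = (A $ r $ c)\<^sup>2" for r c
  proof -
    have "\<exists>!b. b \<in> ?P \<and> covers b r c"
      unfolding covers_def using assms by (intro ex1_partition_block) auto
    then obtain b0 where b0: "b0 \<in> ?P \<and> covers b0 r c"
      "\<forall>b. b \<in> ?P \<and> covers b r c \<longrightarrow> b = b0" by (rule ex1E)
    have "(\<Sum>b\<in>?P. if covers b r c then (A $ r $ c)\<^sup>2 else 0)
        = (\<Sum>b\<in>?P. if b = b0 then (A $ r $ c)\<^sup>2 else 0)"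
      by (rule sum.cong) (use b0 in auto)
    then show ?thesis using fin b0(1) by simp
  qed
  have block: "(norm (blk a s pt b A))\<^sup>2
      = (\<Sum>r\<in>UNIV. \<Sum>c\<in>UNIV. if covers b r c then (A $ r $ c)\<^sup>2 else 0)" for b
    unfolding norm_matrix_sq
    by (intro sum.cong refl) (auto simp: blk_def submat_def cluster_def covers_def split: prod.split)
  have "(\<Sum>b\<in>?P. (norm (blk a s pt b A))\<^sup>2)
      = (\<Sum>r\<in>UNIV. \<Sum>b\<in>?P. \<Sum>c\<in>UNIV. if covers b r c then (A $ r $ c)\<^sup>2 else 0)"
    unfolding block by (rule sum.swap)
  also have "\<dots> = (\<Sum>r\<in>UNIV. \<Sum>c\<in>UNIV. \<Sum>b\<in>?P. if covers b r c then (A $ r $ c)\<^sup>2 else 0)"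
    by (intro sum.cong refl sum.swap)
  finally show ?thesis by (simp add: entry norm_matrix_sq)
qed

lemma norm_blk_le: "norm (blk a s pt b A) \<le> norm A"
proof (rule power2_le_imp_le)
  show "(norm (blk a s pt b A))\<^sup>2 \<le> (norm A)\<^sup>2"
    unfolding norm_matrix_sq
    by (intro sum_mono) (auto simp: blk_def submat_def split: prod.split)
qed simp


section \<open>Counting the admissible blocks\<close>

text \<open>The cubes with a given parent have, in each coordinate, one of two possible indices.\<close>

lemma card_IL_w:
  fixes i :: "'d::finite \<Rightarrow> nat"
  shows "real (card (IL_w l i)) \<le> const3 CARD('d)"
proof -
  let ?S = "PiE UNIV (\<lambda>c. {2 * (i c div 2), Suc (2 * (i c div 2))})"
  have fin: "finite ?S" by (intro finite_PiE) auto
  have card: "card ?S = 2 ^ CARD('d)" by (simp add: card_PiE numeral_2_eq_2)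
  have half: "n div 2 = q \<Longrightarrow> n = 2 * q \<or> n = 2 * q + 1" for n q :: nat by presburger
  have sub: "IL_w l i \<subseteq> ?S - {i}"
    unfolding IL_w_def parent_def fun_eq_iff using half by (fastforce simp: fun_eq_iff)
  have "card (IL_w l i) \<le> card (?S - {i})" using fin sub by (intro card_mono) auto
  moreover have "i \<in> ?S" using half by auto
  ultimately have "card (IL_w l i) \<le> 2 ^ CARD('d) - 1" using fin by (simp add: card)
  then have "real (card (IL_w l i)) \<le> real (2 ^ CARD('d) - 1)" by (rule of_nat_mono)
  then show ?thesis by (simp add: const3_def of_nat_diff)
qed

text \<open>A block of level \<open>l\<close> gets the weight \<open>1 / 2^(d l)\<close>, the reciprocal of the number of cubes at
  that level, so the weight of a level is the average size of the neighbour sets \<open>B i\<close>.\<close>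

lemma sum_weight_level_le:
  fixes B :: "('d::finite \<Rightarrow> nat) \<Rightarrow> ('d \<Rightarrow> nat) set"
  assumes "\<And>i. i \<in> nodes l \<Longrightarrow> real (card (B i)) \<le> C" and "\<And>i. B i \<subseteq> nodes l"
  shows "(\<Sum>b\<in>{l} \<times> (SIGMA i:nodes l. B i). 1 / 2 ^ (CARD('d) * fst b)) \<le> C"
proof -
  have fin: "finite (B i)" for i using assms(2) finite_nodes finite_subset by blast
  have "(\<Sum>b\<in>{l} \<times> (SIGMA i:nodes l. B i). 1 / 2 ^ (CARD('d) * fst b) :: real)
      = (\<Sum>b\<in>{l} \<times> (SIGMA i:nodes l. B i). 1 / 2 ^ (CARD('d) * l))"
    by (rule sum.cong) auto
  also have "\<dots> = (\<Sum>i\<in>nodes l. real (card (B i))) / 2 ^ (CARD('d) * l)"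
    by (simp add: card_cartesian_product finite_nodes fin)
  also have "\<dots> \<le> (\<Sum>i\<in>(nodes l :: ('d \<Rightarrow> nat) set). C) / 2 ^ (CARD('d) * l)"
    by (intro divide_right_mono sum_mono assms(1)) auto
  also have "\<dots> = C" by (simp add: card_nodes)
  finally show ?thesis .
qed

text \<open>Each level up to \<open>m\<close> contributes its far field, level \<open>m\<close> its near field, and each level
  below \<open>m\<close> in the tree the siblings.\<close>

lemma sum_weight_adm_blocks_le:
  fixes a :: "real^'d" and D :: "'d block set"
  assumes "\<forall>l\<in>{1..m}. \<forall>i\<in>nodes l. real (card (IL_s a s \<eta> l i)) \<le> C1"
    and "\<forall>i\<in>nodes m. real (card (Near_s a s \<eta> m i)) \<le> C2"
  shows "(\<Sum>b\<in>adm_blocks a s \<eta> m L D. 1 / 2 ^ (CARD('d) * fst b))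
      \<le> real m * C1 + C2 + real (L - m) * const3 CARD('d)"
proof -
  let ?w = "\<lambda>b :: 'd block. 1 / 2 ^ (CARD('d) * fst b) :: real"
  let ?lev = "\<lambda>B l. {l} \<times> (SIGMA i:nodes l. B l i) :: 'd block set"
  let ?F = "\<Union>l\<in>{1..m}. ?lev (IL_s a s \<eta>) l" and ?N = "?lev (Near_s a s \<eta>) m"
    and ?W = "\<Union>l\<in>{m+1..L}. ?lev IL_w l"
  have sub: "IL_s a s \<eta> l i \<subseteq> nodes l" "Near_s a s \<eta> l i \<subseteq> nodes l"
    "(IL_w l i :: ('d \<Rightarrow> nat) set) \<subseteq> nodes l" for l i
    by (auto simp: IL_s_def Near_s_def IL_w_def)
  have fin: "finite (?lev B l)" if "\<And>i. B l i \<subseteq> nodes l" for B l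
    using that finite_nodes finite_subset by (intro finite_cartesian_product finite_SigmaI) blast+
  have finF: "finite ?F" and finN: "finite ?N" and finW: "finite ?W"
    using fin[of "IL_s a s \<eta>"] fin[of "Near_s a s \<eta>"] fin[of IL_w] sub by auto
  have "adm_blocks a s \<eta> m L D \<subseteq> ?F \<union> (?N \<union> ?W)"
    by (auto simp: adm_blocks_def far_blocks_def near_blocks_def weak_blocks_def)
  then have "sum ?w (adm_blocks a s \<eta> m L D) \<le> sum ?w (?F \<union> (?N \<union> ?W))"
    using finF finN finW by (intro sum_mono2) auto
  also have "\<dots> \<le> sum ?w ?F + (sum ?w ?N + sum ?w ?W)"
  proof -
    have un: "sum ?w (S \<union> T) \<le> sum ?w S + sum ?w T" if "finite S" "finite T" for S T
      using sum.union_inter[OF that, of ?w] sum_nonneg[of "S \<inter> T" ?w] by simp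
    show ?thesis using un[OF finF, of "?N \<union> ?W"] un[OF finN finW] finN finW by simp
  qed
  also have "\<dots> \<le> real m * C1 + (C2 + real (L - m) * const3 CARD('d))"
  proof (intro add_mono)
    have "sum ?w ?F = (\<Sum>l\<in>{1..m}. sum ?w (?lev (IL_s a s \<eta>) l))"
      by (rule sum.UNION_disjoint) (use fin[of "IL_s a s \<eta>"] sub in auto)
    also have "\<dots> \<le> (\<Sum>l\<in>{1..m}. C1)"
      using assms(1) sub by (intro sum_mono sum_weight_level_le) auto
    finally show "sum ?w ?F \<le> real m * C1" by simp
    show "sum ?w ?N \<le> C2"
      using assms(2) sub by (intro sum_weight_level_le) auto
    have "sum ?w ?W = (\<Sum>l\<in>{m+1..L}. sum ?w (?lev IL_w l))"
      by (rule sum.UNION_disjoint) (use fin[of IL_w] sub in auto)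
    also have "\<dots> \<le> (\<Sum>l\<in>{m+1..L}. const3 CARD('d))"
      using sub card_IL_w by (intro sum_mono sum_weight_level_le) auto
    finally show "sum ?w ?W \<le> real (L - m) * const3 CARD('d)" by simp
  qed
  finally show ?thesis by (simp add: add.assoc)
qed


section \<open>Rounding the factors of a low-rank block\<close>

lemma norm_mult_transpose_sq:
  fixes A :: "real^'p^'n" and B :: "real^'p^'k"
  shows "(norm (A ** transpose B))\<^sup>2 = (\<Sum>r\<in>UNIV. (norm (A *v (B $ r)))\<^sup>2)"
proof -
  have "(A ** transpose B) $ i $ r = (A *v (B $ r)) $ i" for i r
    by (simp add: matrix_matrix_mult_def matrix_vector_mult_def transpose_def)
  then have "(norm (A ** transpose B))\<^sup>2 = (\<Sum>i\<in>UNIV. \<Sum>r\<in>UNIV. ((A *v (B $ r)) $ i)\<^sup>2)"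
    by (simp add: norm_matrix_sq)
  also have "\<dots> = (\<Sum>r\<in>UNIV. \<Sum>i\<in>UNIV. ((A *v (B $ r)) $ i)\<^sup>2)" by (rule sum.swap)
  finally show ?thesis by (simp add: norm_vector_sq)
qed

lemma norm_mult_transpose_le:
  fixes A :: "real^'p^'n" and B :: "real^'p^'k"
  shows "norm (A ** transpose B) \<le> onorm (\<lambda>x. A *v x) * norm B"
proof -
  have bl: "bounded_linear (\<lambda>x. A *v x)" by (rule matrix_vector_mul_bounded_linear)
  have "(norm (A ** transpose B))\<^sup>2 \<le> (\<Sum>r\<in>UNIV. (onorm (\<lambda>x. A *v x) * norm (B $ r))\<^sup>2)"
    unfolding norm_mult_transpose_sq by (intro sum_mono power_mono onorm[OF bl]) auto
  also have "\<dots> = (onorm (\<lambda>x. A *v x) * norm B)\<^sup>2"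
    by (simp add: power_mult_distrib norm_sq_rows sum_distrib_left)
  finally show ?thesis
    by (rule power2_le_imp_le) (intro mult_nonneg_nonneg onorm_pos_le[OF bl] norm_ge_zero)
qed

lemma norm_matrix_vector_le:
  fixes E :: "real^'p^'n"
  shows "norm (E *v x) \<le> norm E * norm x"
proof (rule power2_le_imp_le)
  have "(norm (E *v x))\<^sup>2 = (\<Sum>i\<in>UNIV. (E $ i \<bullet> x)\<^sup>2)"
    by (simp add: norm_vector_sq matrix_vector_mul_component)
  also have "\<dots> \<le> (\<Sum>i\<in>UNIV. (norm (E $ i) * norm x)\<^sup>2)"
    by (intro sum_mono) (simp add: abs_le_square_iff[symmetric] Cauchy_Schwarz_ineq2)
  also have "\<dots> = (norm E * norm x)\<^sup>2"
    by (simp add: power_mult_distrib norm_sq_rows sum_distrib_right)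
  finally show "(norm (E *v x))\<^sup>2 \<le> (norm E * norm x)\<^sup>2" .
qed simp

text \<open>The reason is the identity
  \<open>\<parallel>U x\<parallel>\<^sup>2 - \<parallel>x\<parallel>\<^sup>2 = \<langle>x, (U\<^sup>T U - 1) x\<rangle>\<close>.\<close>

lemma near_isometry:
  fixes U :: "real^'p^'n"
  assumes "norm (transpose U ** U - mat 1) \<le> t"
  shows "\<bar>(norm (U *v x))\<^sup>2 - (norm x)\<^sup>2\<bar> \<le> t * (norm x)\<^sup>2"
proof -
  let ?E = "transpose U ** U - mat 1"
  have "(norm (U *v x))\<^sup>2 = x \<bullet> (transpose U *v (U *v x))"
    by (simp add: power2_norm_eq_inner dot_lmul_matrix[symmetric] inner_commute)
  also have "\<dots> = x \<bullet> ((transpose U ** U) *v x)" by (simp add: matrix_vector_mul_assoc)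
  finally have "(norm (U *v x))\<^sup>2 - (norm x)\<^sup>2 = x \<bullet> (?E *v x)"
    by (simp add: matrix_vector_mult_diff_rdistrib inner_diff_right power2_norm_eq_inner)
  also have "\<bar>\<dots>\<bar> \<le> norm x * norm (?E *v x)" by (rule Cauchy_Schwarz_ineq2)
  also have "\<dots> \<le> norm x * (t * norm x)"
    using order_trans[OF norm_matrix_vector_le mult_right_mono[OF assms norm_ge_zero]]
    by (intro mult_left_mono) auto
  finally show ?thesis by (simp add: power2_eq_square mult_ac)
qed

text \<open>For exactly orthonormal columns this is \<open>\<parallel>V\<parallel> = \<parallel>U V\<^sup>T\<parallel>\<close>; a deviation \<open>t\<close> costs the factor
  \<open>sqrt ((1 + t) / (1 - t))\<close>, which is at most \<open>1 + 2 t\<close> for \<open>t \<le> 1 / 2\<close>.\<close>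

lemma onorm_mult_norm_le:
  fixes U :: "real^'p^'n" and V :: "real^'p^'k"
  assumes "norm (transpose U ** U - mat 1) \<le> t" and "0 \<le> t" and "t \<le> 1 / 2"
  shows "onorm (\<lambda>x. U *v x) * norm V \<le> (1 + 2 * t) * norm (U ** transpose V)"
proof (rule power2_le_imp_le)
  note iso = near_isometry[OF assms(1)]
  have bl: "bounded_linear (\<lambda>x. U *v x)" by (rule matrix_vector_mul_bounded_linear)
  have "onorm (\<lambda>x. U *v x) \<le> sqrt (1 + t)"
  proof (rule onorm_bound)
    show "norm (U *v x) \<le> sqrt (1 + t) * norm x" for x
    proof (rule power2_le_imp_le)
      show "(norm (U *v x))\<^sup>2 \<le> (sqrt (1 + t) * norm x)\<^sup>2"
        using iso[of x] assms(2) by (simp add: power_mult_distrib algebra_simps)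
    qed (use assms(2) in simp)
  qed (use assms(2) in simp)
  then have "(onorm (\<lambda>x. U *v x))\<^sup>2 \<le> (sqrt (1 + t))\<^sup>2"
    by (rule power_mono) (rule onorm_pos_le[OF bl])
  then have U2: "(onorm (\<lambda>x. U *v x))\<^sup>2 \<le> 1 + t" using assms(2) by simp
  have V2: "(1 - t) * (norm V)\<^sup>2 \<le> (norm (U ** transpose V))\<^sup>2"
    unfolding norm_mult_transpose_sq norm_sq_rows[of V] sum_distrib_left
  proof (rule sum_mono)
    show "(1 - t) * (norm (V $ r))\<^sup>2 \<le> (norm (U *v V $ r))\<^sup>2" for r
      using iso[of "V $ r"] by (simp add: algebra_simps abs_le_iff)
  qed
  have "t * t \<le> 1 / 2 * (1 / 2)" using assms(2,3) by (intro mult_mono) auto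
  then have "0 \<le> t * (2 - 4 * (t * t))" using assms(2) by (intro mult_nonneg_nonneg) auto
  then have factor: "1 + t \<le> (1 + 2 * t)\<^sup>2 * (1 - t)"
    by (simp add: power2_eq_square algebra_simps)
  have "(onorm (\<lambda>x. U *v x) * norm V)\<^sup>2 \<le> (1 + t) * (norm V)\<^sup>2"
    unfolding power_mult_distrib using U2 by (intro mult_right_mono) auto
  also have "\<dots> \<le> (1 + 2 * t)\<^sup>2 * (1 - t) * (norm V)\<^sup>2"
    using factor by (intro mult_right_mono) auto
  also have "\<dots> \<le> (1 + 2 * t)\<^sup>2 * (norm (U ** transpose V))\<^sup>2"
    unfolding mult.assoc using V2 by (intro mult_left_mono) auto
  finally show "(onorm (\<lambda>x. U *v x) * norm V)\<^sup>2 \<le> ((1 + 2 * t) * norm (U ** transpose V))\<^sup>2"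
    by (simp add: power_mult_distrib)
qed (use assms(2) in simp)

lemma norm_stored_in_diff_le:
  fixes A :: "real^'p^'n"
  assumes "stored_in u A Ahat" and "0 \<le> u"
  shows "norm (Ahat - A) \<le> u * norm A"
proof (rule power2_le_imp_le)
  have "((Ahat - A) $ r $ c)\<^sup>2 \<le> u\<^sup>2 * (A $ r $ c)\<^sup>2" for r c
  proof -
    obtain e where e: "\<bar>e\<bar> \<le> u" "Ahat $ r $ c = A $ r $ c * (1 + e)"
      using assms(1) unfolding stored_in_def by blast
    have "(Ahat - A) $ r $ c = e * A $ r $ c" by (simp add: e(2) algebra_simps)
    then have "((Ahat - A) $ r $ c)\<^sup>2 = e\<^sup>2 * (A $ r $ c)\<^sup>2"
      by (simp add: power_mult_distrib)
    also have "\<dots> \<le> u\<^sup>2 * (A $ r $ c)\<^sup>2"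
      using e(1) assms(2) by (intro mult_right_mono) (auto simp: abs_le_square_iff[symmetric])
    finally show ?thesis .
  qed
  then show "(norm (Ahat - A))\<^sup>2 \<le> (u * norm A)\<^sup>2"
    unfolding power_mult_distrib norm_matrix_sq sum_distrib_left by (intro sum_mono)
qed (use assms(2) in simp)

text \<open>The product of the perturbed factors differs from \<open>U V\<^sup>T\<close> by \<open>\<Delta>U V\<^sup>T + U \<Delta>V\<^sup>T + \<Delta>U \<Delta>V\<^sup>T\<close>.
  Measuring the left factors in the operator norm and the right ones in the Frobenius norm bounds the
  three terms by \<open>u\<close>, \<open>u\<close> and \<open>u\<^sup>2\<close> times \<open>\<parallel>U\<parallel> \<parallel>V\<parallel>\<close>, and the near orthonormality of \<open>U\<close> turns this
  product of norms back into the norm of the product.\<close>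

lemma norm_rounded_product_diff_le:
  fixes U Uh :: "real^'p^'n" and V Vh :: "real^'p^'k"
  assumes "norm (transpose U ** U - mat 1) \<le> t" and "0 \<le> t" and "t \<le> 1 / 2" and "0 \<le> u"
    and dU: "onorm (\<lambda>x. (Uh - U) *v x) \<le> u * onorm (\<lambda>x. U *v x)"
    and dV: "norm (Vh - V) \<le> u * norm V"
  shows "norm (U ** transpose V - Uh ** transpose Vh)
      \<le> (2 + u) * (1 + 2 * t) * u * norm (U ** transpose V)"
proof -
  let ?o = "\<lambda>A :: real^'p^'n. onorm (\<lambda>x. A *v x)"
  have o0: "0 \<le> ?o A" for A by (intro onorm_pos_le matrix_vector_mul_bounded_linear)
  have split: "U ** transpose V - Uh ** transpose Vh
      = - ((Uh - U) ** transpose V + U ** transpose (Vh - V) + (Uh - U) ** transpose (Vh - V))"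
    by (simp add: vec_eq_iff matrix_matrix_mult_def transpose_def sum.distrib[symmetric]
        sum_subtractf[symmetric] sum_negf[symmetric] algebra_simps)
  have "norm ((Uh - U) ** transpose V) \<le> u * ?o U * norm V"
    using norm_mult_transpose_le mult_right_mono[OF dU norm_ge_zero] by (rule order_trans)
  moreover have "norm (U ** transpose (Vh - V)) \<le> ?o U * (u * norm V)"
    using norm_mult_transpose_le mult_left_mono[OF dV o0] by (rule order_trans)
  moreover have "norm ((Uh - U) ** transpose (Vh - V)) \<le> (u * ?o U) * (u * norm V)"
    using norm_mult_transpose_le mult_mono[OF dU dV mult_nonneg_nonneg[OF \<open>0 \<le> u\<close> o0] norm_ge_zero]
    by (rule order_trans)
  ultimately have "norm (U ** transpose V - Uh ** transpose Vh)
      \<le> u * ?o U * norm V + ?o U * (u * norm V) + (u * ?o U) * (u * norm V)"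
    unfolding split norm_minus_cancel by (intro norm_triangle_le add_mono)
  also have "\<dots> = ((2 + u) * u) * (?o U * norm V)" by (simp add: algebra_simps)
  also have "\<dots> \<le> ((2 + u) * u) * ((1 + 2 * t) * norm (U ** transpose V))"
    using \<open>0 \<le> u\<close> by (intro mult_left_mono onorm_mult_norm_le assms(1-3)) auto
  finally show ?thesis by (simp add: mult_ac)
qed


section \<open>Summing the block errors\<close>

lemma partition_blocks_eq:
  assumes "dense_choice a s \<eta> m L D"
  shows "partition_blocks a s \<eta> m L = adm_blocks a s \<eta> m L D \<union> dense_blocks L D"
  using assms by (auto simp: partition_blocks_def adm_blocks_def dense_blocks_def dense_choice_def)

lemma compression_error:
  fixes a :: "real^'d" and pt :: "'n::finite \<Rightarrow> real^'d" and H Ht :: "real^'n^'n"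
  assumes "0 < s" and "0 < \<eta>" and "m \<le> L" and "\<forall>n. pt n \<in> cube a s 0 (\<lambda>_. 0)"
    and "dense_choice a s \<eta> m L D" and "0 \<le> \<epsilon>" and "Hh_matrix a s pt \<eta> m L D p \<epsilon> H Ht"
  shows "norm (H - Ht) \<le> \<epsilon> * norm H"
proof (rule power2_le_imp_le)
  let ?P = "partition_blocks a s \<eta> m L"
  note sq = norm_sq_eq_sum_blocks[OF assms(1-4)]
  have "norm (blk a s pt b (H - Ht)) \<le> \<epsilon> * norm (blk a s pt b H)" if "b \<in> ?P" for b
    using that assms(6,7) unfolding partition_blocks_eq[OF assms(5)] Hh_matrix_def blk_diff by auto
  then have "(norm (H - Ht))\<^sup>2 \<le> (\<Sum>b\<in>?P. (\<epsilon> * norm (blk a s pt b H))\<^sup>2)"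
    unfolding sq[of "H - Ht"] by (intro sum_mono power_mono) auto
  also have "\<dots> = (\<epsilon> * norm H)\<^sup>2"
    by (simp add: power_mult_distrib sq[of H] sum_distrib_left)
  finally show "(norm (H - Ht))\<^sup>2 \<le> (\<epsilon> * norm H)\<^sup>2" .
qed (use assms(6) in simp)

text \<open>The precision rule is chosen so that the absolute error of a block depends on its level
  only: the block norm cancels against \<open>\<xi>\<close>.\<close>

lemma precision_cond_block:
  fixes a :: "real^'d" and pt :: "'n::finite \<Rightarrow> real^'d" and Ht :: "real^'n^'n"
  assumes "precision_cond a s pt \<eta> m L D \<epsilon> u Ht" and "b \<in> adm_blocks a s \<eta> m L D" and "0 \<le> \<epsilon>"
  shows "u b * norm (blk a s pt b Ht) \<le> \<epsilon> * norm Ht * sqrt (1 / 2 ^ (CARD('d) * fst b))"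
proof -
  obtain l i j where b: "b = (l, i, j)" by (cases b)
  have "2 powr (real (CARD('d) * l) / 2) = sqrt (2 powr real (CARD('d) * l))"
    by (simp add: powr_half_sqrt[symmetric] powr_powr)
  then have pw: "2 powr (real (CARD('d) * l) / 2) = sqrt (2 ^ (CARD('d) * l))"
    by (simp only: powr_realpow zero_less_numeral)
  show ?thesis
  proof (cases "norm (blk a s pt b Ht) = 0")
    case True
    then show ?thesis using assms(3) by simp
  next
    case False
    then have pos: "0 < norm (blk a s pt b Ht)" by simp
    then have Ht: "0 < norm Ht" using norm_blk_le[of a s pt b Ht] by linarith
    have "0 < xi a s pt Ht b" using pos Ht by (simp add: xi_def)
    then have "u b \<le> \<epsilon> / (sqrt (2 ^ (CARD('d) * l)) * xi a s pt Ht b)"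
      using assms(1,2) unfolding precision_cond_def b pw[symmetric] by fastforce
    then have "u b * norm (blk a s pt b Ht)
        \<le> \<epsilon> / (sqrt (2 ^ (CARD('d) * l)) * xi a s pt Ht b) * norm (blk a s pt b Ht)"
      using pos by (intro mult_right_mono) auto
    also have "\<dots> = \<epsilon> * norm Ht * sqrt (1 / 2 ^ (CARD('d) * fst b))"
      using False Ht by (simp add: xi_def b real_sqrt_divide)
    finally show ?thesis .
  qed
qed

text \<open>The factor \<open>2 + \<delta>\<close> stands for the two rounding errors and their product, the factor
  \<open>1 + 2 \<kappa> w\<close> for the loss of orthonormality.\<close>

lemma rounding_error:
  fixes a :: "real^'d" and pt :: "'n::finite \<Rightarrow> real^'d" and Ht Hh :: "real^'n^'n"
    and U V Uh Vh :: "'d block \<Rightarrow> real^'p^'n"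
  assumes "0 < s" and "0 < \<eta>" and "m \<le> L" and "\<forall>n. pt n \<in> cube a s 0 (\<lambda>_. 0)"
    and "dense_choice a s \<eta> m L D"
    and C1: "\<forall>l\<in>{1..m}. \<forall>i\<in>nodes l. real (card (IL_s a s \<eta> l i)) \<le> C1"
    and C2: "\<forall>i\<in>nodes m. real (card (Near_s a s \<eta> m i)) \<le> C2"
    and "0 \<le> \<epsilon>" and "0 \<le> \<kappa> * w" and "\<kappa> * w \<le> 1 / 2" and "0 \<le> \<delta>"
    and u: "\<forall>b\<in>adm_blocks a s \<eta> m L D. 0 < u b \<and> u b \<le> \<delta>"
    and rep: "mixed_precision_rep a s pt \<eta> m L D \<kappa> w u U V Uh Vh Ht Hh"
    and prec: "precision_cond a s pt \<eta> m L D \<epsilon> u Ht"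
  shows "norm (Ht - Hh) \<le> (2 + \<delta>) * (1 + 2 * (\<kappa> * w)) * \<epsilon> * norm Ht *
           sqrt (real m * C1 + C2 + real (L - m) * const3 CARD('d))"
proof -
  let ?P = "partition_blocks a s \<eta> m L" and ?M = "adm_blocks a s \<eta> m L D"
  let ?S = "real m * C1 + C2 + real (L - m) * const3 CARD('d)"
  define F where "F = (2 + \<delta>) * (1 + 2 * (\<kappa> * w)) * \<epsilon> * norm Ht"
  have "0 \<le> F" unfolding F_def using assms(8-11) by (intro mult_nonneg_nonneg) auto
  have block: "norm (blk a s pt b (Ht - Hh)) \<le> F * sqrt (1 / 2 ^ (CARD('d) * fst b))"
    if b: "b \<in> ?M" for b
  proof -
    obtain l i j where b_eq: "b = (l, i, j)" by (cases b)
    have ub: "0 < u b" "u b \<le> \<delta>" using u b by auto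
    have r: "orthonormal_cols_upto \<kappa> w (U b)" "blk a s pt b Ht = U b ** transpose (V b)"
      "stored_in (u b) (V b) (Vh b)"
      "onorm (\<lambda>x. (Uh b - U b) *v x) \<le> u b * onorm (\<lambda>x. U b *v x)"
      "blk a s pt b Hh = Uh b ** transpose (Vh b)"
      using rep b unfolding mixed_precision_rep_def b_eq by (auto simp: Let_def)
    have "norm (blk a s pt b (Ht - Hh))
        \<le> (2 + u b) * (1 + 2 * (\<kappa> * w)) * u b * norm (blk a s pt b Ht)"
      unfolding blk_diff r(2,5)
      using r(1) ub assms(9,10)
      by (intro norm_rounded_product_diff_le r(4) norm_stored_in_diff_le r(3))
         (auto simp: orthonormal_cols_upto_def)
    also have "\<dots> = (2 + u b) * (1 + 2 * (\<kappa> * w)) * (u b * norm (blk a s pt b Ht))"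
      by (simp add: mult_ac)
    also have "\<dots> \<le> (2 + \<delta>) * (1 + 2 * (\<kappa> * w)) *
        (\<epsilon> * norm Ht * sqrt (1 / 2 ^ (CARD('d) * fst b)))"
      using ub assms(9) by (intro mult_mono precision_cond_block[OF prec b assms(8)]) auto
    finally show ?thesis by (simp add: F_def mult_ac)
  qed
  have fin: "finite ?P" by (rule finite_partition_blocks) fact
  have sub: "?M \<subseteq> ?P" using partition_blocks_eq[OF assms(5)] by blast
  have "(norm (Ht - Hh))\<^sup>2 = (\<Sum>b\<in>?P. (norm (blk a s pt b (Ht - Hh)))\<^sup>2)"
    by (rule norm_sq_eq_sum_blocks[OF assms(1-4)])
  \<comment> \<open>dense blocks agree in both matrices\<close>
  also have "\<dots> = (\<Sum>b\<in>?M. (norm (blk a s pt b (Ht - Hh)))\<^sup>2)"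
  proof (rule sum.mono_neutral_right[OF fin sub], rule ballI)
    fix b assume "b \<in> ?P - ?M"
    then have "b \<in> dense_blocks L D" using partition_blocks_eq[OF assms(5)] by blast
    then show "(norm (blk a s pt b (Ht - Hh)))\<^sup>2 = 0"
      using rep by (simp add: mixed_precision_rep_def blk_diff)
  qed
  also have "\<dots> \<le> (\<Sum>b\<in>?M. (F * sqrt (1 / 2 ^ (CARD('d) * fst b)))\<^sup>2)"
    by (intro sum_mono power_mono block) auto
  also have "\<dots> = F\<^sup>2 * (\<Sum>b\<in>?M. 1 / 2 ^ (CARD('d) * fst b))"
    unfolding power_mult_distrib sum_distrib_left by simp
  also have "\<dots> \<le> F\<^sup>2 * ?S"
    by (intro mult_left_mono sum_weight_adm_blocks_le C1 C2) auto
  finally have "sqrt ((norm (Ht - Hh))\<^sup>2) \<le> sqrt (F\<^sup>2 * ?S)" by (rule real_sqrt_le_mono)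
  then show ?thesis using \<open>0 \<le> F\<close> by (simp add: real_sqrt_mult F_def)
qed

theorem theorem4p3:
  fixes a :: "real^'d" and s \<eta> \<kappa> :: real
    and pt :: "'n::finite \<Rightarrow> real^'d"
    and m L :: nat
    and D :: "'d block set"
  assumes "0 < s" and "0 < \<eta>" and "0 \<le> \<kappa>" and "m \<le> L"
    and "\<forall>n. pt n \<in> cube a s 0 (\<lambda>_. 0)"
    and "dense_choice a s \<eta> m L D"
    and "\<forall>l\<in>{1..L}. \<forall>i\<in>nodes l. real (card (IL_s a s \<eta> l i)) \<le> const1 CARD('d) \<eta>"
    and "\<forall>l\<in>{0..L}. \<forall>i\<in>nodes l. real (card (Near_s a s \<eta> l i)) \<le> const2 CARD('d) \<eta>"
  shows "\<exists>K \<delta>0. 0 < \<delta>0 \<and>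
    (\<forall>(H :: real^'n^'n) (Ht :: real^'n^'n) (Hh :: real^'n^'n)
       (U :: 'd block \<Rightarrow> real^'p^'n) (V :: 'd block \<Rightarrow> real^'p^'n)
       (Uh :: 'd block \<Rightarrow> real^'p^'n) (Vh :: 'd block \<Rightarrow> real^'p^'n)
       (u :: 'd block \<Rightarrow> real) (w :: real) (\<epsilon> :: real) (\<delta> :: real).
       \<delta> \<le> \<delta>0 \<and> 0 < \<epsilon> \<and> \<epsilon> \<le> \<delta> \<and> 0 < w \<and> w \<le> \<delta> \<and>
       (\<forall>b \<in> adm_blocks a s \<eta> m L D. 0 < u b \<and> u b \<le> \<delta>) \<and>
       Hh_matrix a s pt \<eta> m L D CARD('p) \<epsilon> H Ht \<and>
       mixed_precision_rep a s pt \<eta> m L D \<kappa> w u U V Uh Vh Ht Hh \<and>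
       precision_cond a s pt \<eta> m L D \<epsilon> u Ht \<longrightarrow>
       norm (H - Hh) \<le>
         (2 * sqrt (real m * const1 CARD('d) \<eta> + const2 CARD('d) \<eta>
                    + real (L - m) * const3 CARD('d)) + 1) * \<epsilon> * norm H
         + K * \<epsilon> * \<delta> * norm H)"
proof -
  define S where "S = real m * const1 CARD('d) \<eta> + const2 CARD('d) \<eta>
                    + real (L - m) * const3 CARD('d)"
  have "0 \<le> 2 * sqrt (real CARD('d)) / \<eta>"
    by (rule divide_nonneg_pos[OF _ assms(2)]) simp
  then have "1 \<le> (1 + 2 * sqrt (real CARD('d)) / \<eta>) ^ CARD('d)"
    by (intro one_le_power) linarith
  then have "0 \<le> const2 CARD('d) \<eta>" by (simp only: const2_def diff_ge_0_iff_ge)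
  moreover have "const1 CARD('d) \<eta> = const3 CARD('d) * (const2 CARD('d) \<eta> + 1)"
    by (simp add: const1_def const2_def const3_def)
  moreover have "0 \<le> const3 CARD('d)" by (simp add: const3_def)
  ultimately have "0 \<le> S" by (simp add: S_def)
  \<comment> \<open>\<open>K\<close> absorbs all but the constant term of \<open>(2 + \<delta>) (1 + 2 \<kappa> \<delta>) (1 + \<delta>)\<close>, whose third
     factor comes from \<open>\<parallel>Ht\<parallel> \<le> (1 + \<delta>) \<parallel>H\<parallel>\<close>\<close>
  define K where "K = (4 + 12 * \<kappa>) * sqrt S"
  define \<delta>0 where "\<delta>0 = 1 / (2 * \<kappa> + 1)"
  have "0 < \<delta>0" using assms(3) by (simp add: \<delta>0_def)
  \<comment> \<open>the threshold makes both \<open>\<delta>\<close> and \<open>\<kappa> \<delta>\<close> small enough for the block estimate\<close>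
  have \<delta>0: "\<delta>0 \<le> 1" "\<kappa> * \<delta>0 \<le> 1 / 2"
    using assms(3) by (simp_all add: \<delta>0_def field_simps)
  show ?thesis
  proof (rule exI[of _ K], rule exI[of _ \<delta>0], intro conjI allI impI)
    fix H Ht Hh :: "real^'n^'n" and U V Uh Vh :: "'d block \<Rightarrow> real^'p^'n"
      and u :: "'d block \<Rightarrow> real" and w \<epsilon> \<delta> :: real
    assume "\<delta> \<le> \<delta>0 \<and> 0 < \<epsilon> \<and> \<epsilon> \<le> \<delta> \<and> 0 < w \<and> w \<le> \<delta> \<and>
       (\<forall>b \<in> adm_blocks a s \<eta> m L D. 0 < u b \<and> u b \<le> \<delta>) \<and>
       Hh_matrix a s pt \<eta> m L D CARD('p) \<epsilon> H Ht \<and>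
       mixed_precision_rep a s pt \<eta> m L D \<kappa> w u U V Uh Vh Ht Hh \<and>
       precision_cond a s pt \<eta> m L D \<epsilon> u Ht"
    then have h: "\<delta> \<le> \<delta>0" "0 < \<epsilon>" "\<epsilon> \<le> \<delta>" "0 < w" "w \<le> \<delta>"
      and u: "\<forall>b \<in> adm_blocks a s \<eta> m L D. 0 < u b \<and> u b \<le> \<delta>"
      and Hhm: "Hh_matrix a s pt \<eta> m L D CARD('p) \<epsilon> H Ht"
      and rep: "mixed_precision_rep a s pt \<eta> m L D \<kappa> w u U V Uh Vh Ht Hh"
      and prec: "precision_cond a s pt \<eta> m L D \<epsilon> u Ht" by blast+
    have \<delta>: "0 \<le> \<delta>" "\<delta> \<le> 1" using h \<delta>0 by linarith+
    have \<kappa>w: "0 \<le> \<kappa> * w" "\<kappa> * w \<le> \<kappa> * \<delta>" using h assms(3) by (auto intro: mult_left_mono)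
    have \<kappa>\<delta>: "\<kappa> * \<delta> \<le> 1 / 2" using mult_left_mono[OF h(1) assms(3)] \<delta>0(2) by linarith
    have comp: "norm (H - Ht) \<le> \<epsilon> * norm H"
      using h by (intro compression_error[OF assms(1,2,4,5,6) _ Hhm]) auto
    have Ht: "norm Ht \<le> (1 + \<delta>) * norm H"
    proof -
      have "norm Ht \<le> norm H + norm (H - Ht)" by norm
      also have "\<dots> \<le> norm H + \<delta> * norm H"
        using comp mult_right_mono[OF h(3), of "norm H"] by auto
      finally show ?thesis by (simp add: algebra_simps)
    qed
    have "norm (Ht - Hh) \<le> (2 + \<delta>) * (1 + 2 * (\<kappa> * w)) * \<epsilon> * norm Ht * sqrt S"
      unfolding S_def
      by (rule rounding_error[OF assms(1,2,4,5,6) _ _ _ _ _ _ u rep prec])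
         (use assms(4,7,8) h \<delta> \<kappa>w \<kappa>\<delta> in auto)
    also have "\<dots> = ((2 + \<delta>) * (1 + 2 * (\<kappa> * w))) * norm Ht * (\<epsilon> * sqrt S)"
      by (simp add: mult_ac)
    also have "\<dots> \<le> (2 + (1 + 6 * \<kappa>) * \<delta>) * ((1 + \<delta>) * norm H) * (\<epsilon> * sqrt S)"
    proof (intro mult_right_mono mult_mono Ht)
      have "(2 + \<delta>) * (1 + 2 * (\<kappa> * w)) \<le> (2 + \<delta>) * (1 + 2 * (\<kappa> * \<delta>))"
        using \<kappa>w \<delta> by (intro mult_left_mono) auto
      also have "\<dots> = 2 + \<delta> + 4 * (\<kappa> * \<delta>) + 2 * ((\<kappa> * \<delta>) * \<delta>)" by (simp add: algebra_simps)
      also have "(\<kappa> * \<delta>) * \<delta> \<le> \<kappa> * \<delta>"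
        using \<delta> assms(3) by (intro mult_right_le_one_le) auto
      finally show "(2 + \<delta>) * (1 + 2 * (\<kappa> * w)) \<le> 2 + (1 + 6 * \<kappa>) * \<delta>"
        by (simp add: algebra_simps)
    qed (use h \<delta> assms(3) \<open>0 \<le> S\<close> in auto)
    also have "\<dots> = ((2 + (1 + 6 * \<kappa>) * \<delta>) * (1 + \<delta>)) * (norm H * (\<epsilon> * sqrt S))"
      by (simp add: mult_ac)
    also have "\<dots> \<le> (2 + (4 + 12 * \<kappa>) * \<delta>) * (norm H * (\<epsilon> * sqrt S))"
    proof (rule mult_right_mono)
      have "(1 + 6 * \<kappa>) * (\<delta> * \<delta>) \<le> (1 + 6 * \<kappa>) * \<delta>"
        using \<delta> assms(3) by (intro mult_left_mono mult_right_le_one_le) auto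
      moreover have "0 \<le> \<kappa> * \<delta>" using \<delta> assms(3) by simp
      ultimately show "(2 + (1 + 6 * \<kappa>) * \<delta>) * (1 + \<delta>) \<le> 2 + (4 + 12 * \<kappa>) * \<delta>"
        by (simp add: algebra_simps)
    qed (use h \<open>0 \<le> S\<close> in simp)
    finally have "norm (Ht - Hh) \<le> 2 * sqrt S * \<epsilon> * norm H + K * \<epsilon> * \<delta> * norm H"
      by (simp add: K_def algebra_simps)
    moreover have "norm (H - Hh) \<le> norm (H - Ht) + norm (Ht - Hh)" by norm
    ultimately show "norm (H - Hh) \<le>
         (2 * sqrt (real m * const1 CARD('d) \<eta> + const2 CARD('d) \<eta>
                    + real (L - m) * const3 CARD('d)) + 1) * \<epsilon> * norm H
         + K * \<epsilon> * \<delta> * norm H"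
      using comp unfolding S_def[symmetric] by (simp add: algebra_simps)
  qed fact
qed

end
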